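(* Let $C$ be a chord diagram whose interlace graph $G$ has all degrees even, and for each framing $\varphi$ of $C$ let $\mathfrak{i}_\varphi\colon V_G\times V_G\to\mathbb{Z}/2$ be its intersection form. (1) If $x,y\in V_G$ are not connected by an edge then $\mathfrak{i}_\varphi(x,y)\equiv\mathfrak{e}^2(x,y)\equiv\operatorname{Card}(N(x)\cap N(y))\pmod 2$. (2) The cohomology class in $H^1(G;\mathbb{Z}/2)$ of the intersection cocycle $\mathfrak{i}_\varphi\in Z^1(G;\mathbb{Z}/2)$ is independent of the framing $\varphi$ of $C$. (3) Each cocycle in this cohomology class arises from exactly $2^{b_0}$ framings of $C$, where $b_0=\dim H^0(G;\mathbb{Z}/2)$. (In particular $\mathfrak{i}_\varphi$ determines $\varphi$ up to inverting the framing of all chords in unions of connected components of $G$.)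
   Context: A chord diagram is a finite cyclic word $C$ in which every letter appears exactly twice, up to relabelling; its letters are called chords. A framing of $C$ is a function $\varphi\colon C\to\{0,\infty\}$ giving different values to the two occurrences of each letter; the occurrences of $x$ are then denoted $x_0,x_\infty$. The interlace graph $G$ has vertex set $V_G$ the set of chords and edge set $E_G$ the pairs of chords whose occurrences alternate along the cyclic word; $\mathfrak{e}\colon V_G\times V_G\to\{0,1\}$ is its adjacency matrix and $N(x)$ the set of neighbours of $x$. For distinct occurrences $p,q$ in $C$, $(p,q)$ denotes the open interval of occurrences met strictly between $p$ and $q$ when travelling from $p$ to $q$ in the cyclic order. With the convention $1/0=\infty$ and $1/\infty=0$, the intersection form of the framed chord diagram $C_\varphi$ is $$\mathfrak{i}_\varphi(x,y)=\mathfrak{e}(x,y)+\operatorname{Card}\{z_j\in C_\varphi\mid z_j\in(x_\infty,x_0)\text{ and }z_{1/j}\in(y_\infty,y_0)\}\in\mathbb{Z}/2.$$ Its restriction to $E_G$ is the intersection cocycle, still denoted $\mathfrak{i}_\varphi\in Z^1(G;\mathbb{Z}/2)$ ($G$ is viewed as a $1$-dimensional complex, so every $\mathbb{Z}/2$-valued function on edges is a cocycle). *)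

theory Defs
  imports Complex_Main "HOL-Library.Z2" "HOL-Library.Function_Algebras" "HOL-Library.FuncSet"
begin

section \<open>Cochains of a graph over \<open>\<int>/2\<close>\<close>

text \<open>
  A simple graph is given by a vertex set \<open>V\<close> and a set \<open>E\<close> of two-element subsets of \<open>V\<close>,
  and is regarded as a 1-dimensional complex.
  The library type \<^typ>\<open>bit\<close> is the field \<open>\<int>/2\<close>. Cochains are total functions that vanish
  outside the cells, so that they form linear subspaces of the pointwise function space.
\<close>

definition C0 :: "'a set \<Rightarrow> ('a \<Rightarrow> bit) set" where
  "C0 V = {f. \<forall>x. x \<notin> V \<longrightarrow> f x = 0}"

definition C1 :: "'a set set \<Rightarrow> ('a set \<Rightarrow> bit) set" where
  "C1 E = {c. \<forall>e. e \<notin> E \<longrightarrow> c e = 0}"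

definition coboundary :: "'a set set \<Rightarrow> ('a \<Rightarrow> bit) \<Rightarrow> 'a set \<Rightarrow> bit" where
  "coboundary E f = (\<lambda>e. if e \<in> E then (\<Sum>x\<in>e. f x) else 0)"

text \<open>There are no 2-cells, so every 1-cochain is a cocycle.\<close>

abbreviation Z1 :: "'a set set \<Rightarrow> ('a set \<Rightarrow> bit) set" where
  "Z1 E \<equiv> C1 E"

definition B1 :: "'a set \<Rightarrow> 'a set set \<Rightarrow> ('a set \<Rightarrow> bit) set" where
  "B1 V E = coboundary E ` C0 V"

text \<open>The element of \<open>H\<^sup>1 = Z\<^sup>1 / B\<^sup>1\<close> represented by \<open>c\<close>, as a coset.\<close>

definition H1_class :: "'a set \<Rightarrow> 'a set set \<Rightarrow> ('a set \<Rightarrow> bit) \<Rightarrow> ('a set \<Rightarrow> bit) set" where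
  "H1_class V E c = {c' \<in> Z1 E. c' - c \<in> B1 V E}"

definition H0 :: "'a set \<Rightarrow> 'a set set \<Rightarrow> ('a \<Rightarrow> bit) set" where
  "H0 V E = {f \<in> C0 V. coboundary E f = 0}"

definition scale_fun :: "bit \<Rightarrow> ('a \<Rightarrow> bit) \<Rightarrow> 'a \<Rightarrow> bit" where
  "scale_fun a f = (\<lambda>x. a * f x)"

lemma vector_space_scale_fun: "vector_space scale_fun"
  by unfold_locales (auto simp: scale_fun_def fun_eq_iff algebra_simps)

definition b0 :: "'a set \<Rightarrow> 'a set set \<Rightarrow> nat" where
  "b0 V E = vector_space.dim scale_fun (H0 V E)"

definition components :: "'a set \<Rightarrow> 'a set set \<Rightarrow> 'a set set" where
  "components V E = V // {(x, y). x \<in> V \<and> y \<in> V \<and> (x, y) \<in> {(u, v). {u, v} \<in> E}\<^sup>*}"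


section \<open>Chord diagrams\<close>

text \<open>
  A finite cyclic word is represented by one of its linear representatives \<open>C\<close>. The
  occurrences are the positions \<open>{..<length C}\<close>, so that \<open>V\<^sub>G = set C\<close>; all notions
  below refer to positions only through the cyclic intervals \<open>arc\<close>.
\<close>

definition chord_diagram :: "'a list \<Rightarrow> bool" where
  "chord_diagram C \<longleftrightarrow> (\<forall>x\<in>set C. count_list C x = 2)"

text \<open>
  The open interval \<open>(p, q)\<close> of the cyclic order on \<open>{..<n}\<close>; it is only used for \<open>p \<noteq> q\<close>.
\<close>

definition arc :: "nat \<Rightarrow> nat \<Rightarrow> nat \<Rightarrow> nat set" where
  "arc n p q = {r. r < n \<and> (if p < q then p < r \<and> r < q else p < r \<or> r < q)}"

definition interlaced :: "'a list \<Rightarrow> 'a \<Rightarrow> 'a \<Rightarrow> bool" where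
  "interlaced C x y \<longleftrightarrow> (\<exists>p<length C. \<exists>q<length C. p \<noteq> q \<and> C ! p = x \<and> C ! q = x \<and>
     (\<exists>r \<in> arc (length C) p q. \<exists>s \<in> arc (length C) q p. C ! r = y \<and> C ! s = y))"

definition edges :: "'a list \<Rightarrow> 'a set set" where
  "edges C = {{x, y} | x y. x \<in> set C \<and> y \<in> set C \<and> x \<noteq> y \<and> interlaced C x y}"

definition adj :: "'a list \<Rightarrow> 'a \<Rightarrow> 'a \<Rightarrow> nat" where
  "adj C x y = (if {x, y} \<in> edges C then 1 else 0)"

definition nbrs :: "'a list \<Rightarrow> 'a \<Rightarrow> 'a set" where
  "nbrs C x = {y \<in> set C. {x, y} \<in> edges C}"

text \<open>The values \<open>0\<close>, \<open>\<infinity>\<close> of a framing, and the map \<open>j \<mapsto> 1/j\<close>.\<close>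

datatype frame = Zero | Infty

fun recip :: "frame \<Rightarrow> frame" where
  "recip Zero = Infty"
| "recip Infty = Zero"

definition framings :: "'a list \<Rightarrow> (nat \<Rightarrow> frame) set" where
  "framings C = {\<phi> \<in> {..<length C} \<rightarrow>\<^sub>E UNIV.
     \<forall>p<length C. \<forall>q<length C. p \<noteq> q \<and> C ! p = C ! q \<longrightarrow> \<phi> p \<noteq> \<phi> q}"

text \<open>\<open>occ C \<phi> x j\<close> is the occurrence \<open>x\<^sub>j\<close>.\<close>

definition occ :: "'a list \<Rightarrow> (nat \<Rightarrow> frame) \<Rightarrow> 'a \<Rightarrow> frame \<Rightarrow> nat" where
  "occ C \<phi> x j = (THE p. p < length C \<and> C ! p = x \<and> \<phi> p = j)"

definition framed_arc :: "'a list \<Rightarrow> (nat \<Rightarrow> frame) \<Rightarrow> 'a \<Rightarrow> nat set" where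
  "framed_arc C \<phi> x = arc (length C) (occ C \<phi> x Infty) (occ C \<phi> x Zero)"

definition intersection_form :: "'a list \<Rightarrow> (nat \<Rightarrow> frame) \<Rightarrow> 'a \<Rightarrow> 'a \<Rightarrow> bit" where
  "intersection_form C \<phi> x y = of_nat (adj C x y + card {occ C \<phi> z j | z j. z \<in> set C \<and>
     occ C \<phi> z j \<in> framed_arc C \<phi> x \<and> occ C \<phi> z (recip j) \<in> framed_arc C \<phi> y})"

text \<open>
  The form is symmetric (lemma \<open>intersection_form_sym\<close> below), so its restriction to
  unordered pairs is well defined (lemma \<open>intersection_cocycle_edge\<close>).
\<close>

definition intersection_cocycle :: "'a list \<Rightarrow> (nat \<Rightarrow> frame) \<Rightarrow> 'a set \<Rightarrow> bit" where
  "intersection_cocycle C \<phi> = (\<lambda>e. if e \<in> edges C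
     then (THE v. \<exists>x y. e = {x, y} \<and> v = intersection_form C \<phi> x y) else 0)"

definition invert_framing :: "'a list \<Rightarrow> 'a set \<Rightarrow> (nat \<Rightarrow> frame) \<Rightarrow> nat \<Rightarrow> frame" where
  "invert_framing C U \<phi> = (\<lambda>p\<in>{..<length C}. if C ! p \<in> U then recip (\<phi> p) else \<phi> p)"


section \<open>Well-definedness\<close>

lemma recip_recip [simp]: "recip (recip j) = j"
  by (cases j) auto

lemma occ_props:
  assumes "chord_diagram C" "\<phi> \<in> framings C" "x \<in> set C"
  shows "occ C \<phi> x j < length C" "C ! occ C \<phi> x j = x" "\<phi> (occ C \<phi> x j) = j"
proof -
  have "card {i. i < length C \<and> C ! i = x} = 2"
    using assms(1,3)
    by (auto simp: chord_diagram_def count_list_eq_length_filter length_filter_conv_card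
        eq_commute[of x])
  then obtain a b where ab: "{i. i < length C \<and> C ! i = x} = {a, b}" "a \<noteq> b"
    by (auto simp: card_2_iff)
  have mem: "i < length C \<and> C ! i = x \<longleftrightarrow> i = a \<or> i = b" for i
    using ab(1) by blast
  have ne: "\<phi> a \<noteq> \<phi> b"
    using assms(2) mem[of a] mem[of b] ab(2) by (simp add: framings_def)
  have "\<phi> a = j \<or> \<phi> b = j"
    using ne by (cases j; cases "\<phi> a"; cases "\<phi> b") auto
  then have "\<exists>!p. (p = a \<or> p = b) \<and> \<phi> p = j"
    using ne by auto
  then have "\<exists>!p. p < length C \<and> C ! p = x \<and> \<phi> p = j"
    by (simp only: mem[symmetric] conj_assoc)
  from theI'[OF this]
  show "occ C \<phi> x j < length C" "C ! occ C \<phi> x j = x" "\<phi> (occ C \<phi> x j) = j"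
    unfolding occ_def by auto
qed

lemma intersection_form_sym:
  assumes "chord_diagram C" "\<phi> \<in> framings C"
  shows "intersection_form C \<phi> x y = intersection_form C \<phi> y x"
proof -
  define S where "S = (\<lambda>x y. {(z, j). z \<in> set C \<and> occ C \<phi> z j \<in> framed_arc C \<phi> x \<and>
    occ C \<phi> z (recip j) \<in> framed_arc C \<phi> y})"
  have inj: "inj_on (\<lambda>(z, j). occ C \<phi> z j) (S u v)" for u v
    by (rule inj_on_inverseI[where g = "\<lambda>p. (C ! p, \<phi> p)"])
      (auto simp: S_def occ_props(2,3)[OF assms])
  have "{occ C \<phi> z j | z j. z \<in> set C \<and> occ C \<phi> z j \<in> framed_arc C \<phi> u \<and>
      occ C \<phi> z (recip j) \<in> framed_arc C \<phi> v} = (\<lambda>(z, j). occ C \<phi> z j) ` S u v" for u v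
    unfolding S_def by auto
  then have form: "intersection_form C \<phi> u v = of_nat (adj C u v + card (S u v))" for u v
    using card_image[OF inj, of u v] by (simp add: intersection_form_def)
  have "bij_betw (\<lambda>(z, j). (z, recip j)) (S x y) (S y x)"
    by (rule bij_betwI[where g = "\<lambda>(z, j). (z, recip j)"]) (auto simp: S_def)
  then have "card (S x y) = card (S y x)"
    by (rule bij_betw_same_card)
  then show ?thesis
    by (simp add: form adj_def insert_commute)
qed

lemma intersection_cocycle_edge:
  assumes "chord_diagram C" "\<phi> \<in> framings C" "{x, y} \<in> edges C"
  shows "intersection_cocycle C \<phi> {x, y} = intersection_form C \<phi> x y"
proof -
  have "(THE v. \<exists>a b. {x, y} = {a, b} \<and> v = intersection_form C \<phi> a b)
      = intersection_form C \<phi> x y"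
    by (rule the_equality)
      (auto simp: doubleton_eq_iff intersection_form_sym[OF assms(1,2), of y x])
  then show ?thesis
    using assms(3) by (simp add: intersection_cocycle_def)
qed

end

(* Writing e for the adjacency matrix and A(x) for the arc from the infinity-occurrence to the
   zero-occurrence of x, e(x,z) is modulo 2 the number of ends of z in A(x). Expanding e^2 and
   counting both ends of every chord gives, for every framing,
     i(x,y) = e(x,y) + e^2(x,y) + |A(x) \<inter> A(y)|  (mod 2).
   Even degrees make every |A(x)| even. For unlinked x, y the two arcs are disjoint, nested or cover
   the circle, so |A(x) \<inter> A(y)| is even. Inverting the framing of y complements A(y) up to the
   two ends of y, which changes |A(x) \<inter> A(y)|, hence i(x,y), by e(x,y). Thus passing to another
   framing adds the coboundary of the indicator of the inverted chords, and framings with a given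
   cocycle form a torsor under H^0. *)
theory Submission
  imports Defs
begin

section \<open>The intersection form through arcs\<close>

lemma of_nat_bit_eq_0_iff: "(of_nat n :: bit) = 0 \<longleftrightarrow> even n"
  by (induction n) auto

lemma UNIV_frame: "UNIV = {Zero, Infty}"
  by (auto intro: frame.exhaust)

lemma ex_frame: "(\<exists>j. P j) \<longleftrightarrow> P Zero \<or> P Infty"
  using UNIV_frame by (metis (full_types) frame.exhaust)

lemma recip_neq [simp]: "recip j \<noteq> j" "j \<noteq> recip j"
  by (cases j; simp)+

lemma occ_eqI:
  assumes "chord_diagram C" "\<phi> \<in> framings C" "p < length C" "C ! p = x" "\<phi> p = j"
  shows "occ C \<phi> x j = p"
proof (rule ccontr)
  assume ne: "occ C \<phi> x j \<noteq> p"
  have "x \<in> set C"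
    using assms(3,4) by auto
  note occ_props[OF assms(1,2) this, of j]
  with ne assms show False
    by (auto simp: framings_def)
qed

lemma occ_eq_iff:
  assumes "chord_diagram C" "\<phi> \<in> framings C" "x \<in> set C" "y \<in> set C"
  shows "occ C \<phi> x j = occ C \<phi> y k \<longleftrightarrow> x = y \<and> j = k"
  by (metis assms occ_props(2,3))

lemma positions_iff:
  assumes "chord_diagram C" "\<phi> \<in> framings C" "x \<in> set C"
  shows "p < length C \<and> C ! p = x \<longleftrightarrow> p = occ C \<phi> x Zero \<or> p = occ C \<phi> x Infty"
proof
  assume "p < length C \<and> C ! p = x"
  then have "occ C \<phi> x (\<phi> p) = p"
    by (auto intro: occ_eqI[OF assms(1,2)])
  then show "p = occ C \<phi> x Zero \<or> p = occ C \<phi> x Infty"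
    by (cases "\<phi> p") auto
qed (auto simp: occ_props(1,2)[OF assms])

text \<open>Every position is the end of exactly one pair of a chord and a frame value, so a set of
  positions can be counted chord by chord. All parity arguments below use this form.\<close>

lemma card_positions:
  assumes "chord_diagram C" "\<phi> \<in> framings C" "S \<subseteq> {..<length C}"
  shows "card S = (\<Sum>z\<in>set C. of_bool (occ C \<phi> z Zero \<in> S) + of_bool (occ C \<phi> z Infty \<in> S))"
proof -
  have bij: "bij_betw (\<lambda>(z, j). occ C \<phi> z j) (set C \<times> UNIV) {..<length C}"
    by (rule bij_betwI[where g = "\<lambda>p. (C ! p, \<phi> p)"])
      (auto simp: occ_props[OF assms(1,2)] occ_eqI[OF assms(1,2) _ refl refl])
  have "S = {..<length C} \<inter> {p. p \<in> S}"
    using assms(3) by auto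
  then have "card S = (\<Sum>p<length C. of_bool (p \<in> S))"
    by simp
  also have "\<dots> = (\<Sum>(z, j)\<in>set C \<times> UNIV. of_bool (occ C \<phi> z j \<in> S))"
    using sum.reindex_bij_betw[OF bij, of "\<lambda>p. of_bool (p \<in> S) :: nat"]
    by (simp add: case_prod_unfold del: sum_of_bool_eq)
  also have "\<dots> = (\<Sum>z\<in>set C. \<Sum>j\<in>UNIV. of_bool (occ C \<phi> z j \<in> S))"
    by (rule sum.cartesian_product[symmetric])
  finally show ?thesis
    by (simp add: UNIV_frame del: sum_of_bool_eq)
qed

lemma even_length: "chord_diagram C \<Longrightarrow> \<phi> \<in> framings C \<Longrightarrow> even (length C)"
  using card_positions[of C \<phi> "{..<length C}"] by (simp add: occ_props(1))

section \<open>Arcs and interlacement\<close>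

lemma arc_subset: "arc n p q \<subseteq> {..<n}"
  by (auto simp: arc_def)

lemma arc_flip: "p \<noteq> q \<Longrightarrow> arc n q p = {..<n} - arc n p q - {p, q}"
  by (auto simp: arc_def)

lemma framed_arc_subset: "framed_arc C \<phi> x \<subseteq> {..<length C}"
  unfolding framed_arc_def by (rule arc_subset)

lemma finite_framed_arc [simp]: "finite (framed_arc C \<phi> x)"
  using finite_subset[OF framed_arc_subset] by simp

lemma occ_notin_framed_arc: "occ C \<phi> x j \<notin> framed_arc C \<phi> x"
  by (cases j) (auto simp: framed_arc_def arc_def)

text \<open>Linked chords are those separated by the arc: the two arcs cut out by \<open>x\<close>
  are complementary up to the ends of \<open>x\<close>, so \<open>z\<close> meets both exactly when
  one of its two ends lies in \<open>framed_arc C \<phi> x\<close>. For \<open>x = z\<close> both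
  sides fail, since the arc is open.\<close>

lemma interlaced_iff:
  assumes "chord_diagram C" "\<phi> \<in> framings C" "x \<in> set C" "z \<in> set C"
  shows "x \<noteq> z \<and> interlaced C x z \<longleftrightarrow>
    (occ C \<phi> z Zero \<in> framed_arc C \<phi> x) \<noteq> (occ C \<phi> z Infty \<in> framed_arc C \<phi> x)"
proof (cases "x = z")
  case True
  then show ?thesis
    by (simp add: occ_notin_framed_arc)
next
  case False
  let ?n = "length C"
  let ?p = "occ C \<phi> x Infty" and ?q = "occ C \<phi> x Zero"
  note px = occ_props[OF assms(1,2,3)] and pz = occ_props[OF assms(1,2,4)]
  have pq: "?p \<noteq> ?q"
    by (simp add: occ_eq_iff[OF assms(1,2,3,3)])
  have flip: "arc ?n ?q ?p = {..<?n} - arc ?n ?p ?q - {?p, ?q}"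
    using pq by (rule arc_flip)
  note pos = positions_iff[OF assms(1,2)]
  have zn: "occ C \<phi> z j \<notin> {?p, ?q}" for j
    using False assms by (simp add: occ_eq_iff)
  \<comment> \<open>The ends of \<open>z\<close> avoid those of \<open>x\<close>, so an end lies in
    one of the two arcs if and only if it is missing from the other.\<close>
  have zin: "occ C \<phi> z j \<in> arc ?n ?q ?p \<longleftrightarrow> occ C \<phi> z j \<notin> arc ?n ?p ?q" for j
    using zn[of j] pz(1)[of j] by (auto simp: flip)
  define I where "I = (\<lambda>p q. \<exists>r \<in> arc ?n p q. \<exists>s \<in> arc ?n q p. C ! r = z \<and> C ! s = z)"
  have I: "I p q \<longleftrightarrow> (\<exists>j k. occ C \<phi> z j \<in> arc ?n p q \<and> occ C \<phi> z k \<in> arc ?n q p)" for p q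
  proof
    assume "I p q"
    then obtain r s where rs: "r \<in> arc ?n p q" "s \<in> arc ?n q p" "C ! r = z" "C ! s = z"
      unfolding I_def by auto
    with arc_subset have "r < ?n" "s < ?n"
      by blast+
    then have "occ C \<phi> z (\<phi> r) = r" "occ C \<phi> z (\<phi> s) = s"
      using rs(3,4) by (auto intro: occ_eqI[OF assms(1,2)])
    with rs(1,2) have "occ C \<phi> z (\<phi> r) \<in> arc ?n p q \<and> occ C \<phi> z (\<phi> s) \<in> arc ?n q p"
      by simp
    then show "\<exists>j k. occ C \<phi> z j \<in> arc ?n p q \<and> occ C \<phi> z k \<in> arc ?n q p"
      by blast
  next
    assume "\<exists>j k. occ C \<phi> z j \<in> arc ?n p q \<and> occ C \<phi> z k \<in> arc ?n q p"
    with pz(2) show "I p q"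
      unfolding I_def by blast
  qed
  have il: "interlaced C x z" if "I p q" "p < ?n" "q < ?n" "p \<noteq> q" "C ! p = x" "C ! q = x" for p q
    using that unfolding interlaced_def I_def by blast
  \<comment> \<open>The definition of \<open>interlaced\<close> leaves the order of the two ends of
    \<open>x\<close> open; both orders have to be covered, and they yield the same
    condition.\<close>
  have "interlaced C x z \<longleftrightarrow> I ?p ?q \<or> I ?q ?p"
  proof
    assume "interlaced C x z"
    then obtain p q where pq': "p < ?n \<and> C ! p = x" "q < ?n \<and> C ! q = x" "p \<noteq> q" "I p q"
      unfolding interlaced_def I_def by blast
    then have "p = ?q \<or> p = ?p" "q = ?q \<or> q = ?p"
      unfolding pos[OF assms(3)] by simp_all
    with pq'(3,4) show "I ?p ?q \<or> I ?q ?p"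
      by (elim disjE) simp_all
  next
    assume "I ?p ?q \<or> I ?q ?p"
    then show "interlaced C x z"
      using il[OF _ px(1) px(1) pq px(2) px(2)] il[OF _ px(1) px(1) pq[symmetric] px(2) px(2)]
      by (elim disjE)
  qed
  also have "\<dots> \<longleftrightarrow> (\<exists>j k. occ C \<phi> z j \<in> arc ?n ?p ?q \<and> occ C \<phi> z k \<notin> arc ?n ?p ?q)"
    unfolding I zin by blast
  also have "\<dots> \<longleftrightarrow> (occ C \<phi> z Zero \<in> arc ?n ?p ?q) \<noteq> (occ C \<phi> z Infty \<in> arc ?n ?p ?q)"
    by (simp add: ex_frame) blast
  finally show ?thesis
    using False by (simp add: framed_arc_def)
qed

lemma interlaced_sym:
  assumes "interlaced C x y"
  shows "interlaced C y x"
proof -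
  let ?n = "length C"
  obtain p q r s where pq: "p < ?n" "q < ?n" "p \<noteq> q" "C ! p = x" "C ! q = x"
    and rs: "r \<in> arc ?n p q" "s \<in> arc ?n q p" "C ! r = y" "C ! s = y"
    using assms unfolding interlaced_def by blast
  \<comment> \<open>The cyclic order is \<open>p, r, q, s\<close>; starting at \<open>r\<close>
    instead of \<open>p\<close> exchanges the roles of the two chords.\<close>
  have "r < ?n" "s < ?n" "r \<noteq> s" "q \<in> arc ?n r s" "p \<in> arc ?n s r"
    using pq rs by (auto simp: arc_def split: if_splits)
  with pq rs show ?thesis
    unfolding interlaced_def by blast
qed

lemma edges_iff:
  "{x, y} \<in> edges C \<longleftrightarrow> x \<in> set C \<and> y \<in> set C \<and> x \<noteq> y \<and> interlaced C x y"
  by (auto simp: edges_def doubleton_eq_iff dest: interlaced_sym)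

text \<open>In \<open>bit\<close> the sum of the two indicators is 1 exactly when one end lies in
  the arc and the other does not, which is linkedness.\<close>

lemma adj_eq_ends:
  assumes "chord_diagram C" "\<phi> \<in> framings C" "x \<in> set C" "z \<in> set C"
  shows "(of_nat (adj C x z) :: bit) =
    of_bool (occ C \<phi> z Zero \<in> framed_arc C \<phi> x) + of_bool (occ C \<phi> z Infty \<in> framed_arc C \<phi> x)"
  using interlaced_iff[OF assms] assms(3,4) by (auto simp: adj_def edges_iff)

lemma adj_sym: "adj C x y = adj C y x"
  by (simp add: adj_def insert_commute)

section \<open>The form as adjacency, squared adjacency and overlap of arcs\<close>

text \<open>The first two summands do not involve the framing, so the whole dependence on
  \<open>\<phi>\<close> is moved into the size of the overlap of two arcs.\<close>

lemma intersection_form_eq: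
  assumes "chord_diagram C" "\<phi> \<in> framings C" "x \<in> set C" "y \<in> set C"
  shows "intersection_form C \<phi> x y = of_nat (adj C x y)
    + of_nat (\<Sum>z\<in>set C. adj C x z * adj C z y)
    + of_nat (card (framed_arc C \<phi> x \<inter> framed_arc C \<phi> y))"
proof -
  let ?o = "occ C \<phi>" and ?A = "framed_arc C \<phi> x" and ?B = "framed_arc C \<phi> y"
  define T where "T = {?o z j | z j. z \<in> set C \<and> ?o z j \<in> ?A \<and> ?o z (recip j) \<in> ?B}"
  \<comment> \<open>Since \<open>occ\<close> is injective in chord and frame value, membership in
    \<open>T\<close> can be tested on the given pair instead of on some pair naming the same
    position.\<close>
  have T: "?o z j \<in> T \<longleftrightarrow> ?o z j \<in> ?A \<and> ?o z (recip j) \<in> ?B" if "z \<in> set C" for z j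
  proof
    assume "?o z j \<in> T"
    then obtain z' j' where *: "?o z j = ?o z' j'" "z' \<in> set C" "?o z' j' \<in> ?A" "?o z' (recip j') \<in> ?B"
      unfolding T_def by blast
    then have "z = z' \<and> j = j'"
      using occ_eq_iff[OF assms(1,2) that] by simp
    with * show "?o z j \<in> ?A \<and> ?o z (recip j) \<in> ?B"
      by simp
  next
    show "?o z j \<in> ?A \<and> ?o z (recip j) \<in> ?B \<Longrightarrow> ?o z j \<in> T"
      unfolding T_def using that by blast
  qed
  have "T \<subseteq> {..<length C}"
    unfolding T_def using framed_arc_subset[of C \<phi> x] by blast
  note cT = card_positions[OF assms(1,2) this]
  have "?A \<inter> ?B \<subseteq> {..<length C}"
    using framed_arc_subset[of C \<phi> x] by blast
  note cAB = card_positions[OF assms(1,2) this]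
  have "of_nat (card T) = (of_nat (\<Sum>z\<in>set C. adj C x z * adj C z y) + of_nat (card (?A \<inter> ?B)) :: bit)"
    unfolding cT cAB of_nat_sum sum.distrib[symmetric]
  proof (rule sum.cong[OF refl])
    fix z assume z: "z \<in> set C"
    define a a' b b' where ends: "a = (?o z Zero \<in> ?A)" "a' = (?o z Infty \<in> ?A)"
      "b = (?o z Zero \<in> ?B)" "b' = (?o z Infty \<in> ?B)"
    have adj: "(of_nat (adj C x z) :: bit) = of_bool a + of_bool a'"
      "(of_nat (adj C z y) :: bit) = of_bool b + of_bool b'"
      unfolding ends adj_sym[of C z y]
      by (rule adj_eq_ends[OF assms(1,2,3) z], rule adj_eq_ends[OF assms(1,2,4) z])
    \<comment> \<open>The contribution of a single chord \<open>z\<close>: the left side counts its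
      ends in \<open>T\<close>. Expanding the product gives the mixed terms together with
      \<open>a b\<close> and \<open>a' b'\<close>, and the latter cancel modulo 2.\<close>
    have "of_bool (a \<and> b') + of_bool (a' \<and> b) = ((of_bool a + of_bool a') * (of_bool b + of_bool b')
      + (of_bool (a \<and> b) + of_bool (a' \<and> b')) :: bit)"
      by (cases a; cases a'; cases b; cases b') simp_all
    then show "of_nat (of_bool (?o z Zero \<in> T) + of_bool (?o z Infty \<in> T)) =
      (of_nat (adj C x z * adj C z y) +
       of_nat (of_bool (?o z Zero \<in> ?A \<inter> ?B) + of_bool (?o z Infty \<in> ?A \<inter> ?B)) :: bit)"
      by (simp only: T[OF z] of_nat_add of_nat_mult of_nat_of_bool adj recip.simps Int_iff ends)
  qed
  then show ?thesis
    unfolding intersection_form_def T_def[symmetric] of_nat_add by (simp only: add.assoc)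
qed

section \<open>Parity of arcs and of their overlaps\<close>

lemma sum_adj_eq: "(\<Sum>z\<in>set C. adj C x z) = card (nbrs C x)"
proof -
  have "nbrs C x = set C \<inter> {z. {x, z} \<in> edges C}"
    by (auto simp: nbrs_def)
  then show ?thesis
    by (simp add: adj_def sum.If_cases)
qed

lemma sum_adj_mult_adj_eq: "(\<Sum>z\<in>set C. adj C x z * adj C z y) = card (nbrs C x \<inter> nbrs C y)"
proof -
  have "nbrs C x \<inter> nbrs C y = set C \<inter> {z. {x, z} \<in> edges C \<and> {z, y} \<in> edges C}"
    by (auto simp: nbrs_def insert_commute)
  moreover have "adj C x z * adj C z y = (if {x, z} \<in> edges C \<and> {z, y} \<in> edges C then 1 else 0)" for z
    by (simp add: adj_def)
  ultimately show ?thesis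
    by (simp add: sum.If_cases)
qed

text \<open>A chord has an odd number of ends in the arc of \<open>x\<close> exactly when it is
  linked with \<open>x\<close>, so the size of the arc is congruent to the degree of
  \<open>x\<close>.\<close>

lemma even_card_framed_arc:
  assumes "chord_diagram C" "\<phi> \<in> framings C" "x \<in> set C" "even (card (nbrs C x))"
  shows "even (card (framed_arc C \<phi> x))"
proof -
  have "(of_nat (card (framed_arc C \<phi> x)) :: bit) = (\<Sum>z\<in>set C. of_nat (adj C x z))"
    unfolding card_positions[OF assms(1,2) framed_arc_subset] of_nat_sum
    by (rule sum.cong) (simp_all only: of_nat_add of_nat_of_bool adj_eq_ends[OF assms(1-3)])
  also have "\<dots> = of_nat (card (nbrs C x))"
    by (simp only: of_nat_sum[symmetric] sum_adj_eq)
  finally show ?thesis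
    using assms(4) by (simp add: of_nat_bit_eq_0_iff[symmetric])
qed

text \<open>Two tests decide the case, \<open>r\<close> in the first arc and \<open>p\<close> in the
  second. Both true: the arcs cover the circle. Only the first true: the second arc lies in the
  first. Only the second true: the reverse inclusion. Both false: the arcs are disjoint.\<close>

lemma arc_unlinked_cases:
  assumes "p < n" "q < n" "r < n" "s < n" "distinct [p, q, r, s]"
    and "r \<in> arc n p q \<longleftrightarrow> s \<in> arc n p q"
  shows "arc n p q \<inter> arc n r s = {} \<or> arc n p q \<subseteq> arc n r s \<or> arc n r s \<subseteq> arc n p q
    \<or> arc n p q \<union> arc n r s = {..<n}"
proof -
  have ne: "p \<noteq> q" "p \<noteq> r" "p \<noteq> s" "q \<noteq> r" "q \<noteq> s" "r \<noteq> s"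
    using assms(5) by auto
  \<comment> \<open>Membership is spelled out as inequalities, so that each case becomes a statement
    about linear orders.\<close>
  have mem: "t \<in> arc n a b \<longleftrightarrow> t < n \<and> (a < b \<and> a < t \<and> t < b \<or> \<not> a < b \<and> (a < t \<or> t < b))" for t a b
    by (auto simp: arc_def)
  note assms' = assms(1-4) ne assms(6)[unfolded mem]
  show ?thesis
  proof (cases "r \<in> arc n p q")
    case r: True
    show ?thesis
    proof (cases "p \<in> arc n r s")
      case True
      have "t < n \<Longrightarrow> t \<in> arc n p q \<or> t \<in> arc n r s" for t
        using assms' r True unfolding mem by (smt (verit, best) dual_order.strict_trans nat_neq_iff)
      then show ?thesis using arc_subset by blast
    next
      case False
      have "t \<in> arc n r s \<Longrightarrow> t \<in> arc n p q" for t
        using assms' r False unfolding mem by (smt (verit, best) dual_order.strict_trans nat_neq_iff)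
      then show ?thesis by blast
    qed
  next
    case r: False
    show ?thesis
    proof (cases "p \<in> arc n r s")
      case True
      have "t \<in> arc n p q \<Longrightarrow> t \<in> arc n r s" for t
        using assms' r True unfolding mem by (smt (verit, best) dual_order.strict_trans nat_neq_iff)
      then show ?thesis by blast
    next
      case False
      have "t \<in> arc n p q \<Longrightarrow> t \<notin> arc n r s" for t
        using assms' r False unfolding mem by (smt (verit, best) dual_order.strict_trans nat_neq_iff)
      then show ?thesis by blast
    qed
  qed
qed

lemma even_card_Int_framed_arc:
  assumes "chord_diagram C" "\<phi> \<in> framings C" "x \<in> set C" "y \<in> set C" "{x, y} \<notin> edges C"
    and "even (card (nbrs C x))" "even (card (nbrs C y))"
  shows "even (card (framed_arc C \<phi> x \<inter> framed_arc C \<phi> y))"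
proof (cases "x = y")
  \<comment> \<open>The diagonal counts as unconnected too; there the overlap is the arc
    itself.\<close>
  case True
  then show ?thesis
    using even_card_framed_arc[OF assms(1-3,6)] by simp
next
  case False
  let ?A = "framed_arc C \<phi> x" and ?B = "framed_arc C \<phi> y"
  have "occ C \<phi> y Zero \<in> ?A \<longleftrightarrow> occ C \<phi> y Infty \<in> ?A"
    using interlaced_iff[OF assms(1-4)] assms(3-5) by (auto simp: edges_iff)
  moreover have "distinct [occ C \<phi> x Infty, occ C \<phi> x Zero, occ C \<phi> y Infty, occ C \<phi> y Zero]"
    using False assms(3,4) by (simp add: occ_eq_iff[OF assms(1,2)])
  moreover have "occ C \<phi> w j < length C" if "w \<in> set C" for w j
    using occ_props(1)[OF assms(1,2) that] .
  ultimately consider "?A \<inter> ?B = {}" | "?A \<subseteq> ?B" | "?B \<subseteq> ?A" | "?A \<union> ?B = {..<length C}"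
    using arc_unlinked_cases[of "occ C \<phi> x Infty" "length C" "occ C \<phi> x Zero" "occ C \<phi> y Infty" "occ C \<phi> y Zero"]
      assms(3,4)
    unfolding framed_arc_def by metis
  then show ?thesis
  proof cases
    case 4
    \<comment> \<open>Inclusion-exclusion for a cover of the circle, which has an even number of
      positions.\<close>
    then have "card ?A + card ?B = length C + card (?A \<inter> ?B)"
      using card_Un_Int[of ?A ?B] by simp
    moreover have "even (card ?A)" "even (card ?B)"
      using even_card_framed_arc[OF assms(1,2)] assms(3,4,6,7) by auto
    ultimately show ?thesis
      using even_length[OF assms(1,2)] by (metis even_add)
  qed (use even_card_framed_arc[OF assms(1,2)] assms(3,4,6,7) in \<open>auto simp: Int_absorb1 Int_absorb2\<close>)
qed

section \<open>Change of framing\<close>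

text \<open>The 0-cochain marking the chords on which two framings disagree. Comparing zero ends is
  enough, since a chord has only one other end.\<close>

definition framing_diff :: "'a list \<Rightarrow> (nat \<Rightarrow> frame) \<Rightarrow> (nat \<Rightarrow> frame) \<Rightarrow> 'a \<Rightarrow> bit" where
  "framing_diff C \<phi> \<psi> x = of_bool (x \<in> set C \<and> occ C \<phi> x Zero \<noteq> occ C \<psi> x Zero)"

text \<open>Both framings label the same two positions of \<open>x\<close>, so the labels either
  agree or are swapped.\<close>

lemma occ_flip:
  assumes "chord_diagram C" "\<phi> \<in> framings C" "\<psi> \<in> framings C" "x \<in> set C"
  shows "occ C \<psi> x j = (if framing_diff C \<phi> \<psi> x = 0 then occ C \<phi> x j else occ C \<phi> x (recip j))"
proof -
  have *: "occ C \<psi> x k = occ C \<phi> x Zero \<or> occ C \<psi> x k = occ C \<phi> x Infty" for k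
    using positions_iff[OF assms(1,2,4)] occ_props(1,2)[OF assms(1,3,4)] by blast
  have "occ C \<psi> x Zero \<noteq> occ C \<psi> x Infty" "occ C \<phi> x Zero \<noteq> occ C \<phi> x Infty"
    by (simp_all add: occ_eq_iff[OF assms(1,3,4,4)] occ_eq_iff[OF assms(1,2,4,4)])
  with *[of Zero] *[of Infty]
  consider "occ C \<psi> x Zero = occ C \<phi> x Zero" "occ C \<psi> x Infty = occ C \<phi> x Infty"
    | "occ C \<psi> x Zero = occ C \<phi> x Infty" "occ C \<psi> x Infty = occ C \<phi> x Zero"
      "occ C \<phi> x Zero \<noteq> occ C \<phi> x Infty"
    by metis
  then show ?thesis
  proof cases
    case 1
    then have "framing_diff C \<phi> \<psi> x = 0"
      by (simp add: framing_diff_def)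
    with 1 show ?thesis
      by (cases j) simp_all
  next
    case 2
    then have "framing_diff C \<phi> \<psi> x = 1"
      using assms(4) by (simp add: framing_diff_def)
    with 2 show ?thesis
      by (cases j) simp_all
  qed
qed

lemma framing_diff_nth:
  assumes "chord_diagram C" "\<phi> \<in> framings C" "\<psi> \<in> framings C" "p < length C"
  shows "framing_diff C \<phi> \<psi> (C ! p) = of_bool (\<phi> p \<noteq> \<psi> p)"
proof -
  have x: "C ! p \<in> set C"
    using assms(4) by simp
  have "occ C \<psi> (C ! p) (\<psi> p) = occ C \<phi> (C ! p) (\<phi> p)"
    using occ_eqI[OF assms(1,2,4) refl refl] occ_eqI[OF assms(1,3,4) refl refl] by simp
  then show ?thesis
    unfolding occ_flip[OF assms(1-3) x]
    by (cases "\<phi> p"; cases "\<psi> p") (simp_all add: occ_eq_iff[OF assms(1,2) x x] split: if_splits)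
qed

text \<open>Reversing \<open>y\<close> replaces its arc by the complement without the two ends of
  \<open>y\<close>. As \<open>S\<close> is even, the parts of \<open>S\<close> inside the old and
  the new arc differ in parity by the number of ends of \<open>y\<close> in \<open>S\<close>. Later
  \<open>S\<close> is the arc of another chord.\<close>

lemma card_Int_framed_arc_flip:
  assumes "chord_diagram C" "\<phi> \<in> framings C" "\<psi> \<in> framings C" "y \<in> set C"
    and "S \<subseteq> {..<length C}" "even (card S)"
  shows "(of_nat (card (S \<inter> framed_arc C \<psi> y)) :: bit) = of_nat (card (S \<inter> framed_arc C \<phi> y))
    + framing_diff C \<phi> \<psi> y * (of_bool (occ C \<phi> y Zero \<in> S) + of_bool (occ C \<phi> y Infty \<in> S))"
proof (cases "framing_diff C \<phi> \<psi> y = 0")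
  case True
  then show ?thesis
    unfolding framed_arc_def occ_flip[OF assms(1-4)] by simp
next
  case False
  let ?p = "occ C \<phi> y Infty" and ?q = "occ C \<phi> y Zero"
  let ?A = "framed_arc C \<phi> y"
  have pq: "?p \<noteq> ?q"
    by (simp add: occ_eq_iff[OF assms(1,2,4,4)])
  have fin: "finite S"
    using assms(5) finite_subset by blast
  have "framed_arc C \<psi> y = {..<length C} - ?A - {?p, ?q}"
    unfolding framed_arc_def occ_flip[OF assms(1-4)] using False arc_flip[OF pq] by simp
  then have Spsi: "S \<inter> framed_arc C \<psi> y = S - (S \<inter> ?A) - (S \<inter> {?p, ?q})"
    using assms(5) by blast
  have dis: "S \<inter> {?p, ?q} \<subseteq> S - (S \<inter> ?A)"
    using occ_notin_framed_arc[of C \<phi> y] by blast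
  \<comment> \<open>\<open>S\<close> splits into its parts in the new arc, in the old arc and at the
    ends of \<open>y\<close>.\<close>
  have "card S = card (S \<inter> framed_arc C \<psi> y) + card (S \<inter> ?A) + card (S \<inter> {?p, ?q})"
  proof -
    have "card (S - (S \<inter> ?A) - (S \<inter> {?p, ?q})) = card (S - (S \<inter> ?A)) - card (S \<inter> {?p, ?q})"
      using fin dis by (intro card_Diff_subset) auto
    moreover have "card (S - (S \<inter> ?A)) = card S - card (S \<inter> ?A)"
      using fin by (intro card_Diff_subset) auto
    moreover have "card (S \<inter> ?A) \<le> card S"
      using fin by (intro card_mono) auto
    moreover have "card (S \<inter> {?p, ?q}) \<le> card (S - (S \<inter> ?A))"
      using fin dis by (intro card_mono) auto
    ultimately show ?thesis
      unfolding Spsi by linarith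
  qed
  moreover have "card (S \<inter> {?p, ?q}) = of_bool (?q \<in> S) + of_bool (?p \<in> S)"
    using pq by (cases "?p \<in> S"; cases "?q \<in> S") simp_all
  ultimately have "(of_nat (card S) :: bit) = of_nat (card (S \<inter> framed_arc C \<psi> y)
      + card (S \<inter> ?A) + (of_bool (?q \<in> S) + of_bool (?p \<in> S)))"
    by (simp only:)
  moreover have "(of_nat (card S) :: bit) = 0"
    using assms(6) by (simp only: of_nat_bit_eq_0_iff)
  ultimately have sum: "0 = (of_nat (card (S \<inter> framed_arc C \<psi> y)) :: bit)
      + of_nat (card (S \<inter> ?A)) + (of_bool (?q \<in> S) + of_bool (?p \<in> S))"
    by (simp only: of_nat_add of_nat_of_bool)
  have diff: "framing_diff C \<phi> \<psi> y = 1"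
    using False by simp
  have "a = b + 1 * c" if "0 = a + b + c" for a b c :: bit
    using that by (cases a; cases b; cases c) simp_all
  from this[OF sum] show ?thesis
    unfolding diff .
qed

text \<open>The two chords are reframed one after the other: first \<open>y\<close> against the arc
  of \<open>x\<close> for \<open>\<psi>\<close>, then \<open>x\<close> against the arc of
  \<open>y\<close> for \<open>\<phi>\<close>. Each step contributes its own multiple of the
  adjacency.\<close>

lemma intersection_form_flip:
  assumes "chord_diagram C" "\<phi> \<in> framings C" "\<psi> \<in> framings C" "x \<in> set C" "y \<in> set C"
    and "even (card (nbrs C x))" "even (card (nbrs C y))"
  shows "intersection_form C \<psi> x y = intersection_form C \<phi> x y
    + (framing_diff C \<phi> \<psi> x + framing_diff C \<phi> \<psi> y) * of_nat (adj C x y)"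
proof -
  note sub = framed_arc_subset[of C]
  have 1: "of_nat (card (framed_arc C \<psi> x \<inter> framed_arc C \<psi> y)) =
      (of_nat (card (framed_arc C \<psi> x \<inter> framed_arc C \<phi> y)) + framing_diff C \<phi> \<psi> y * of_nat (adj C x y) :: bit)"
  proof -
    \<comment> \<open>The sum over both ends of \<open>y\<close> does not see which of them is
      labelled zero, so it may be computed with the labels of \<open>\<psi>\<close>.\<close>
    have "of_bool (occ C \<phi> y Zero \<in> framed_arc C \<psi> x) + of_bool (occ C \<phi> y Infty \<in> framed_arc C \<psi> x)
      = (of_nat (adj C x y) :: bit)"
      unfolding adj_eq_ends[OF assms(1,3-5)] occ_flip[OF assms(1-3,5)]
      by (cases "framing_diff C \<phi> \<psi> y = 0") (simp_all add: add.commute)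
    then show ?thesis
      using card_Int_framed_arc_flip[OF assms(1-3,5) sub even_card_framed_arc[OF assms(1,3,4,6)]] by simp
  qed
  have 2: "of_nat (card (framed_arc C \<phi> y \<inter> framed_arc C \<psi> x)) =
      (of_nat (card (framed_arc C \<phi> y \<inter> framed_arc C \<phi> x)) + framing_diff C \<phi> \<psi> x * of_nat (adj C x y) :: bit)"
    using card_Int_framed_arc_flip[OF assms(1-4) sub even_card_framed_arc[OF assms(1,2,5,7)]]
    by (simp only: adj_sym[of C x y] adj_eq_ends[OF assms(1,2,5,4)])
  show ?thesis
    unfolding intersection_form_eq[OF assms(1,2,4,5)] intersection_form_eq[OF assms(1,3,4,5)] 1
      Int_commute[of "framed_arc C \<psi> x" "framed_arc C \<phi> y"] 2
      Int_commute[of "framed_arc C \<phi> y" "framed_arc C \<phi> x"]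
    by (simp only: algebra_simps)
qed

section \<open>Counting framings\<close>

text \<open>By induction on the basis: a new independent vector \<open>a\<close> doubles the span,
  adding the disjoint translate of the old span by \<open>a\<close>.\<close>

lemma card_span_bit:
  fixes scale :: "bit \<Rightarrow> 'b::ab_group_add \<Rightarrow> 'b"
  assumes "vector_space scale" "finite B" "\<not> module.dependent scale B"
  shows "finite (module.span scale B) \<and> card (module.span scale B) = 2 ^ card B"
proof -
  interpret vector_space scale
    by (rule assms(1))
  show ?thesis
    using assms(2,3)
  proof (induction B)
    case empty
    then show ?case
      by simp
  next
    case (insert a B)
    have a: "a \<notin> span B" and ind: "independent B"
      using insert.prems insert.hyps(2) by (simp_all add: independent_insert)
    \<comment> \<open>The coefficient of \<open>a\<close> can only be 0 or 1.\<close>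
    have "x \<in> span (insert a B) \<longleftrightarrow> x \<in> span B \<or> x - a \<in> span B" for x
    proof -
      have ex_bit: "(\<exists>k. P k) \<longleftrightarrow> P 0 \<or> P 1" for P :: "bit \<Rightarrow> bool"
        using bit.exhaust by metis
      show ?thesis
        by (simp add: span_insert ex_bit)
    qed
    moreover have mem: "x \<in> (+) a ` span B \<longleftrightarrow> x - a \<in> span B" for x
      using image_eqI[of x "(+) a" "x - a" "span B"] by auto
    ultimately have un: "span (insert a B) = span B \<union> (+) a ` span B"
      by blast
    have "a \<in> span B" if "x \<in> span B" "x - a \<in> span B" for x
      using span_diff[OF that] by simp
    with a have "span B \<inter> (+) a ` span B = {}"
      unfolding disjoint_iff mem by blast
    then have "card (span (insert a B)) = card (span B) + card ((+) a ` span B)"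
      unfolding un using insert.IH[OF ind] by (intro card_Un_disjoint) auto
    also have "card ((+) a ` span B) = card (span B)"
      by (rule card_image) simp
    finally show ?case
      using insert.IH[OF ind] insert.hyps by (simp add: un)
  qed
qed

lemma coboundary_add: "coboundary E (f + g) = coboundary E f + coboundary E g"
  by (rule ext) (simp only: coboundary_def plus_fun_apply sum.distrib add_0_left split: if_split, simp)

lemma bit_fun_diff_eq_add: "f - g = f + (g :: 'b \<Rightarrow> bit)"
  by (simp add: fun_eq_iff)

lemma coboundary_diff: "coboundary E (f - g) = coboundary E f - coboundary E g"
  by (simp only: bit_fun_diff_eq_add coboundary_add)

lemma C0_add: "f \<in> C0 V \<Longrightarrow> g \<in> C0 V \<Longrightarrow> f + g \<in> C0 V"
  by (simp add: C0_def)

lemma C0_diff: "f \<in> C0 V \<Longrightarrow> g \<in> C0 V \<Longrightarrow> f - g \<in> C0 V"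
  by (simp add: C0_def)

lemma H1_class_eqI:
  assumes "c - c' \<in> B1 V E"
  shows "H1_class V E c = H1_class V E c'"
proof -
  obtain f where f: "f \<in> C0 V" "c - c' = coboundary E f"
    using assms unfolding B1_def by blast
  have B1: "h + coboundary E f \<in> B1 V E" if h: "h \<in> B1 V E" for h
  proof -
    obtain g where g: "g \<in> C0 V" "h = coboundary E g"
      using h unfolding B1_def by blast
    have "g + f \<in> C0 V"
      using g(1) f(1) by (rule C0_add)
    then show ?thesis
      unfolding g(2) coboundary_add[symmetric] B1_def by simp
  qed
  \<comment> \<open>The same cochain is added in both directions, since subtraction is addition in
    characteristic 2.\<close>
  have "d - c' = (d - c) + coboundary E f" "d - c = (d - c') + coboundary E f" for d
    unfolding f(2)[symmetric] by (simp_all add: bit_fun_diff_eq_add fun_eq_iff ac_simps)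
  with B1 have "d - c \<in> B1 V E \<longleftrightarrow> d - c' \<in> B1 V E" for d
    by metis
  then show ?thesis
    unfolding H1_class_def by simp
qed

lemma card_H0:
  assumes "finite V"
  shows "card (H0 V E) = 2 ^ b0 V E"
proof -
  interpret vector_space "scale_fun :: bit \<Rightarrow> ('a \<Rightarrow> bit) \<Rightarrow> 'a \<Rightarrow> bit"
    by (rule vector_space_scale_fun)
  have scale: "scale_fun k f = (if k = 0 then 0 else f)" for k :: bit and f :: "'a \<Rightarrow> bit"
    by (auto simp: scale_fun_def fun_eq_iff)
  have "coboundary E 0 = 0"
    by (auto simp: coboundary_def fun_eq_iff)
  then have sub: "subspace (H0 V E)"
    by (intro subspaceI) (auto simp: H0_def C0_def scale coboundary_add)
  \<comment> \<open>A cochain with values in \<open>bit\<close> is the indicator of its support.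
    Finiteness of \<open>H0\<close> makes its basis finite, as counting the span requires.\<close>
  have "finite (C0 V)"
  proof (rule finite_subset)
    show "C0 V \<subseteq> (\<lambda>S x. of_bool (x \<in> S)) ` Pow V"
    proof
      fix f assume f: "f \<in> C0 V"
      then have "f = (\<lambda>x. of_bool (x \<in> {x. f x = 1}))"
        by (auto simp: fun_eq_iff)
      moreover have "{x. f x = 1} \<in> Pow V"
        using f by (auto simp: C0_def)
      ultimately show "f \<in> (\<lambda>S x. of_bool (x \<in> S)) ` Pow V"
        by (rule image_eqI)
    qed
  qed (use assms in simp)
  then have fin: "finite (H0 V E)"
    by (rule rev_finite_subset) (auto simp: H0_def)
  obtain B where B: "B \<subseteq> H0 V E" "independent B" "H0 V E \<subseteq> span B" "card B = dim (H0 V E)"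
    using basis_exists by blast
  have "span B = H0 V E"
    using B(1,3) sub by (rule span_subspace)
  moreover have "finite B"
    using B(1) fin by (rule finite_subset)
  ultimately show ?thesis
    using card_span_bit[OF vector_space_scale_fun _ B(2)] B(4) by (simp add: b0_def)
qed

lemma coboundary_doubleton:
  assumes "{x, y} \<in> E" "x \<noteq> y"
  shows "coboundary E f {x, y} = f x + f y"
  using assms by (simp add: coboundary_def)

lemma framing_diff_in_C0: "framing_diff C \<phi> \<psi> \<in> C0 (set C)"
  by (simp add: C0_def framing_diff_def)

section \<open>Framings as a torsor under 0-cochains\<close>

text \<open>On an edge the adjacency is 1, so the correction term of the form is the coboundary; off
  the edges all three cochains vanish by convention.\<close>

lemma intersection_cocycle_flip:
  assumes "chord_diagram C" "\<phi> \<in> framings C" "\<psi> \<in> framings C"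
    and "\<forall>x\<in>set C. even (card (nbrs C x))"
  shows "intersection_cocycle C \<psi> = intersection_cocycle C \<phi> + coboundary (edges C) (framing_diff C \<phi> \<psi>)"
proof
  fix e
  show "intersection_cocycle C \<psi> e =
    (intersection_cocycle C \<phi> + coboundary (edges C) (framing_diff C \<phi> \<psi>)) e"
  proof (cases "e \<in> edges C")
    case True
    then obtain x y where e: "e = {x, y}" "x \<in> set C" "y \<in> set C" "x \<noteq> y"
      unfolding edges_def by blast
    have "adj C x y = 1"
      using True e(1) by (simp add: adj_def)
    then have "intersection_form C \<psi> x y = intersection_form C \<phi> x y + (framing_diff C \<phi> \<psi> x + framing_diff C \<phi> \<psi> y)"
      using intersection_form_flip[OF assms(1-3) e(2,3)] assms(4) e(2,3) by (simp only: of_nat_1 mult_1_right)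
    then show ?thesis
      using True unfolding e(1) plus_fun_apply
      by (simp only: intersection_cocycle_edge[OF assms(1,2)] intersection_cocycle_edge[OF assms(1,3)]
          coboundary_doubleton[OF _ e(4)])
  qed (simp add: intersection_cocycle_def coboundary_def)
qed

lemma invert_framing_in_framings:
  assumes "\<phi> \<in> framings C"
  shows "invert_framing C U \<phi> \<in> framings C"
proof -
  have "recip j \<noteq> recip k \<longleftrightarrow> j \<noteq> k" for j k
    by (metis recip_recip)
  then show ?thesis
    using assms by (auto simp: framings_def invert_framing_def)
qed

lemma framing_diff_invert:
  assumes "chord_diagram C" "\<phi> \<in> framings C" "x \<in> set C"
  shows "framing_diff C \<phi> (invert_framing C U \<phi>) x = of_bool (x \<in> U)"
proof -
  obtain p where p: "p < length C" "x = C ! p"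
    using assms(3) by (metis in_set_conv_nth)
  show ?thesis
    unfolding p(2) framing_diff_nth[OF assms(1,2) invert_framing_in_framings[OF assms(2)] p(1)]
    using p(1) by (simp add: invert_framing_def)
qed

lemma invert_framing_diff:
  assumes "chord_diagram C" "\<phi> \<in> framings C" "\<psi> \<in> framings C"
  shows "invert_framing C {x. framing_diff C \<phi> \<psi> x = 1} \<phi> = \<psi>"
proof
  fix p
  show "invert_framing C {x. framing_diff C \<phi> \<psi> x = 1} \<phi> p = \<psi> p"
  proof (cases "p < length C")
    case True
    then show ?thesis
      by (cases "\<phi> p"; cases "\<psi> p") (simp_all add: invert_framing_def framing_diff_nth[OF assms])
  next
    case False
    \<comment> \<open>Outside the word both functions are \<open>undefined\<close>, because framings
      are extensional.\<close>
    then show ?thesis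
      using assms(3) by (auto simp: invert_framing_def framings_def PiE_def extensional_def)
  qed
qed

text \<open>Once a base framing is fixed, framings and 0-cochains determine each other; the inverse
  map inverts the chords in the support of the cochain.\<close>

lemma bij_betw_framing_diff:
  assumes "chord_diagram C" "\<phi> \<in> framings C"
  shows "bij_betw (framing_diff C \<phi>) (framings C) (C0 (set C))"
proof (rule bij_betwI[where g = "\<lambda>f. invert_framing C {x. f x = 1} \<phi>"])
  show "framing_diff C \<phi> (invert_framing C {x. f x = 1} \<phi>) = f" if f: "f \<in> C0 (set C)" for f
  proof
    fix x
    show "framing_diff C \<phi> (invert_framing C {x. f x = 1} \<phi>) x = f x"
    proof (cases "x \<in> set C")
      case True
      then show ?thesis
        by (cases "f x") (simp_all add: framing_diff_invert[OF assms])
    next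
      case False
      then show ?thesis
        using f by (simp add: C0_def framing_diff_def)
    qed
  qed
qed (simp_all add: framing_diff_in_C0 invert_framing_in_framings invert_framing_diff assms)

section \<open>0-cocycles and connected components\<close>

lemma coboundary_eq_0_iff:
  "coboundary (edges C) f = 0 \<longleftrightarrow> (\<forall>x y. {x, y} \<in> edges C \<longrightarrow> f x = f y)"
proof
  assume *: "coboundary (edges C) f = 0"
  show "\<forall>x y. {x, y} \<in> edges C \<longrightarrow> f x = f y"
  proof (intro allI impI)
    fix x y assume e: "{x, y} \<in> edges C"
    then have "f x + f y = 0"
      using coboundary_doubleton[OF e, of f] * by (simp add: edges_iff)
    then show "f x = f y"
      by (cases "f x"; cases "f y") simp_all
  qed
next
  assume *: "\<forall>x y. {x, y} \<in> edges C \<longrightarrow> f x = f y"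
  show "coboundary (edges C) f = 0"
  proof
    fix e
    show "coboundary (edges C) f e = 0 e"
    proof (cases "e \<in> edges C")
      case True
      then obtain x y where e: "e = {x, y}" "x \<noteq> y"
        unfolding edges_def by blast
      then show ?thesis
        using True * coboundary_doubleton[of x y "edges C" f] by auto
    qed (simp add: coboundary_def)
  qed
qed

lemma edge_closed_Union_components:
  assumes "K \<subseteq> components (set C) (edges C)" "{x, y} \<in> edges C" "x \<in> \<Union>K"
  shows "y \<in> \<Union>K"
proof -
  let ?R = "{(x, y). x \<in> set C \<and> y \<in> set C \<and> (x, y) \<in> {(u, v). {u, v} \<in> edges C}\<^sup>*}"
  obtain k where k: "k \<in> K" "x \<in> k"
    using assms(3) by blast
  then obtain w where w: "k = ?R `` {w}"
    using assms(1) unfolding components_def by (blast elim: quotientE)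
  have "(w, x) \<in> ?R"
    using k(2) w by simp
  moreover have "(x, y) \<in> {(u, v). {u, v} \<in> edges C}" "y \<in> set C"
    using assms(2) by (simp_all add: edges_iff)
  ultimately have "(w, y) \<in> ?R"
    by (auto intro: rtrancl_into_rtrancl)
  then show ?thesis
    using k(1) w by blast
qed

text \<open>A set closed under edges contains the whole component of each of its points, by
  induction along paths, and is the union of these components.\<close>

lemma edge_closed_imp_Union_components:
  assumes "U \<subseteq> set C" "\<And>x y. {x, y} \<in> edges C \<Longrightarrow> x \<in> U \<Longrightarrow> y \<in> U"
  shows "\<exists>K \<subseteq> components (set C) (edges C). U = \<Union>K"
proof -
  let ?R = "{(x, y). x \<in> set C \<and> y \<in> set C \<and> (x, y) \<in> {(u, v). {u, v} \<in> edges C}\<^sup>*}"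
  have closed: "y \<in> U" if "(x, y) \<in> {(u, v). {u, v} \<in> edges C}\<^sup>*" "x \<in> U" for x y
    using that by (induction rule: rtrancl_induct) (auto intro: assms(2))
  have "(\<lambda>x. ?R `` {x}) ` U \<subseteq> components (set C) (edges C)"
    unfolding components_def
  proof (rule image_subsetI)
    show "?R `` {x} \<in> set C // ?R" if "x \<in> U" for x
      using assms(1) that by (intro quotientI) blast
  qed
  moreover have "U = \<Union> ((\<lambda>x. ?R `` {x}) ` U)"
    using assms(1) closed by auto
  ultimately show ?thesis
    by blast
qed

text \<open>The coboundary of an indicator vanishes exactly when its support is closed under edges,
  that is, a union of components.\<close>

lemma coboundary_framing_diff_eq_0_iff:
  assumes "chord_diagram C" "\<phi> \<in> framings C" "\<psi> \<in> framings C"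
  shows "coboundary (edges C) (framing_diff C \<phi> \<psi>) = 0 \<longleftrightarrow>
    (\<exists>K \<subseteq> components (set C) (edges C). \<psi> = invert_framing C (\<Union>K) \<phi>)"
proof
  let ?U = "{x. framing_diff C \<phi> \<psi> x = 1}"
  assume "coboundary (edges C) (framing_diff C \<phi> \<psi>) = 0"
  then have "\<And>x y. {x, y} \<in> edges C \<Longrightarrow> x \<in> ?U \<Longrightarrow> y \<in> ?U"
    unfolding coboundary_eq_0_iff by (metis mem_Collect_eq)
  moreover have "?U \<subseteq> set C"
    by (auto simp: framing_diff_def split: if_splits)
  ultimately obtain K where "K \<subseteq> components (set C) (edges C)" "?U = \<Union>K"
    using edge_closed_imp_Union_components by metis
  then show "\<exists>K \<subseteq> components (set C) (edges C). \<psi> = invert_framing C (\<Union>K) \<phi>"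
    using invert_framing_diff[OF assms] by metis
next
  assume "\<exists>K \<subseteq> components (set C) (edges C). \<psi> = invert_framing C (\<Union>K) \<phi>"
  then obtain K where K: "K \<subseteq> components (set C) (edges C)" "\<psi> = invert_framing C (\<Union>K) \<phi>"
    by blast
  show "coboundary (edges C) (framing_diff C \<phi> \<psi>) = 0"
    unfolding coboundary_eq_0_iff
  proof (intro allI impI)
    fix x y assume e: "{x, y} \<in> edges C"
    then have "x \<in> \<Union>K \<longleftrightarrow> y \<in> \<Union>K"
      using edge_closed_Union_components[OF K(1)] by (metis insert_commute)
    then show "framing_diff C \<phi> \<psi> x = framing_diff C \<phi> \<psi> y"
      using e framing_diff_invert[OF assms(1,2)] unfolding K(2) edges_iff by simp
  qed
qed

section \<open>Size of the fibres and the final assembly\<close>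

text \<open>Through \<open>framing_diff\<close> the framings with cocycle \<open>c\<close> become
  the solutions \<open>f\<close> of an affine equation, a translate of \<open>H0\<close>.\<close>

lemma card_framings_of_cocycle:
  assumes "chord_diagram C" "\<phi> \<in> framings C" "\<forall>x\<in>set C. even (card (nbrs C x))"
    and "c \<in> H1_class (set C) (edges C) (intersection_cocycle C \<phi>)"
  shows "card {\<psi> \<in> framings C. intersection_cocycle C \<psi> = c} = 2 ^ b0 (set C) (edges C)"
proof -
  let ?d = "coboundary (edges C)"
  \<comment> \<open>A particular solution, which exists because \<open>c\<close> is cohomologous to
    the cocycle of \<open>\<phi>\<close>.\<close>
  obtain g where g: "g \<in> C0 (set C)" "c - intersection_cocycle C \<phi> = ?d g"
    using assms(4) unfolding H1_class_def B1_def by auto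
  have c: "c = intersection_cocycle C \<phi> + ?d g"
    unfolding g(2)[symmetric] by (subst add.commute) (rule diff_add_cancel[symmetric])
  let ?F = "{\<psi> \<in> framings C. intersection_cocycle C \<psi> = c}"
  have "intersection_cocycle C \<psi> = c \<longleftrightarrow> ?d (framing_diff C \<phi> \<psi>) = ?d g" if "\<psi> \<in> framings C" for \<psi>
    unfolding c intersection_cocycle_flip[OF assms(1,2) that assms(3)] by (rule add_left_cancel)
  then have F: "?F = {\<psi> \<in> framings C. ?d (framing_diff C \<phi> \<psi>) = ?d g}"
    by blast
  have "bij_betw (framing_diff C \<phi>) ?F {f \<in> C0 (set C). ?d f = ?d g}"
    unfolding bij_betw_def
  proof
    show "inj_on (framing_diff C \<phi>) ?F"
      using bij_betw_imp_inj_on[OF bij_betw_framing_diff[OF assms(1,2)]] by (rule inj_on_subset) blast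
    show "framing_diff C \<phi> ` ?F = {f \<in> C0 (set C). ?d f = ?d g}"
      unfolding F bij_betw_imp_surj_on[OF bij_betw_framing_diff[OF assms(1,2)], symmetric] by blast
  qed
  then have "card ?F = card {f \<in> C0 (set C). ?d f = ?d g}"
    by (rule bij_betw_same_card)
  also have "card {f \<in> C0 (set C). ?d f = ?d g} = card (H0 (set C) (edges C))"
  proof (rule bij_betw_same_card)
    \<comment> \<open>Subtracting the particular solution turns the affine equation into the
      homogeneous one.\<close>
    show "bij_betw (\<lambda>f. f - g) {f \<in> C0 (set C). ?d f = ?d g} (H0 (set C) (edges C))"
    proof (rule bij_betwI[where g = "\<lambda>f. f + g"])
      show "(\<lambda>f. f - g) \<in> {f \<in> C0 (set C). ?d f = ?d g} \<rightarrow> H0 (set C) (edges C)"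
        using C0_diff[OF _ g(1)] by (auto simp only: H0_def coboundary_diff diff_self)
      show "(\<lambda>f. f + g) \<in> H0 (set C) (edges C) \<rightarrow> {f \<in> C0 (set C). ?d f = ?d g}"
        using C0_add[OF _ g(1)] by (auto simp only: H0_def coboundary_add add_0_left)
    qed (rule diff_add_cancel, rule add_diff_cancel_right')
  qed
  also have "\<dots> = 2 ^ b0 (set C) (edges C)"
    by (rule card_H0) simp
  finally show ?thesis .
qed

theorem theorem2p14:
  fixes C :: "'a list"
  assumes "chord_diagram C"
    and "\<forall>x\<in>set C. even (card (nbrs C x))"
  shows
    "(\<forall>\<phi>\<in>framings C. \<forall>x\<in>set C. \<forall>y\<in>set C. {x, y} \<notin> edges C \<longrightarrow>
        intersection_form C \<phi> x y = of_nat (\<Sum>z\<in>set C. adj C x z * adj C z y) \<and>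
        (of_nat (\<Sum>z\<in>set C. adj C x z * adj C z y) :: bit)
          = of_nat (card (nbrs C x \<inter> nbrs C y))) \<and>
     (\<forall>\<phi>\<in>framings C. \<forall>\<psi>\<in>framings C.
        H1_class (set C) (edges C) (intersection_cocycle C \<phi>)
          = H1_class (set C) (edges C) (intersection_cocycle C \<psi>)) \<and>
     (\<forall>\<phi>\<in>framings C. \<forall>c\<in>H1_class (set C) (edges C) (intersection_cocycle C \<phi>).
        card {\<psi> \<in> framings C. intersection_cocycle C \<psi> = c} = 2 ^ b0 (set C) (edges C)) \<and>
     (\<forall>\<phi>\<in>framings C. \<forall>\<psi>\<in>framings C.
        intersection_cocycle C \<phi> = intersection_cocycle C \<psi> \<longleftrightarrow>
        (\<exists>K \<subseteq> components (set C) (edges C). \<psi> = invert_framing C (\<Union>K) \<phi>))"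
proof (intro conjI ballI impI)
  fix \<phi> x y
  assume \<phi>: "\<phi> \<in> framings C" and xy: "x \<in> set C" "y \<in> set C" "{x, y} \<notin> edges C"
  have "adj C x y = 0"
    using xy(3) by (simp add: adj_def)
  moreover have "(of_nat (card (framed_arc C \<phi> x \<inter> framed_arc C \<phi> y)) :: bit) = 0"
    unfolding of_nat_bit_eq_0_iff using even_card_Int_framed_arc[OF assms(1) \<phi> xy] assms(2) xy by blast
  ultimately show "intersection_form C \<phi> x y = of_nat (\<Sum>z\<in>set C. adj C x z * adj C z y)"
    unfolding intersection_form_eq[OF assms(1) \<phi> xy(1,2)] by (simp only: of_nat_0 add_0_left add_0_right)
  show "(of_nat (\<Sum>z\<in>set C. adj C x z * adj C z y) :: bit) = of_nat (card (nbrs C x \<inter> nbrs C y))"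
    by (simp only: sum_adj_mult_adj_eq)
next
  \<comment> \<open>Independence of the class and the description of framings with equal cocycles
    both compare two framings and are settled together; the count is left to the closing
    rule.\<close>
  fix \<phi> \<psi>
  assume \<phi>: "\<phi> \<in> framings C" and \<psi>: "\<psi> \<in> framings C"
  have "intersection_cocycle C \<phi> - intersection_cocycle C \<psi> = coboundary (edges C) (framing_diff C \<psi> \<phi>)"
    unfolding intersection_cocycle_flip[OF assms(1) \<psi> \<phi> assms(2)] by simp
  then show "H1_class (set C) (edges C) (intersection_cocycle C \<phi>)
      = H1_class (set C) (edges C) (intersection_cocycle C \<psi>)"
    using framing_diff_in_C0 by (intro H1_class_eqI) (auto simp: B1_def)
  have "intersection_cocycle C \<phi> = intersection_cocycle C \<psi> \<longleftrightarrow>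
      coboundary (edges C) (framing_diff C \<phi> \<psi>) = 0"
    unfolding intersection_cocycle_flip[OF assms(1) \<phi> \<psi> assms(2)] by (metis add_cancel_left_right)
  then show "intersection_cocycle C \<phi> = intersection_cocycle C \<psi> \<longleftrightarrow>
      (\<exists>K \<subseteq> components (set C) (edges C). \<psi> = invert_framing C (\<Union>K) \<phi>)"
    unfolding coboundary_framing_diff_eq_0_iff[OF assms(1) \<phi> \<psi>] .
qed (rule card_framings_of_cocycle[OF assms(1) _ assms(2)])

end
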